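(* Consider the infinitely repeated game described in the context, let $a\in\mathcal N$ be a player, let $n\ge 1$, and let $\hat{\bm\sigma}^{(-1)},\dots,\hat{\bm\sigma}^{(-n)}\in\mathcal A$ be given action profiles. Let $\hat T_a^{(1)}$ be the Press–Dyson vectors of a memory-one strategy of player $a$ such that $\hat T_a^{(1)}\left(\sigma_a^*|\hat{\bm\sigma}^{(-1)}\right)\neq 0$ for some $\sigma_a^*\in A_a$. Then a memory-$n$ strategy of player $a$ whose Press–Dyson tensor is $$\hat T_a\left(\sigma_a|\bm\sigma^{(-1)},\dots,\bm\sigma^{(-n)}\right)=\hat T_a^{(1)}\left(\sigma_a|\bm\sigma^{(-1)}\right)\prod_{m=1}^n\delta_{\bm\sigma^{(-m)},\hat{\bm\sigma}^{(-m)}}\qquad\left(\forall\sigma_a\in A_a,\ \forall\bm\sigma^{(-1)},\dots,\bm\sigma^{(-n)}\in\mathcal A\right)$$ unilaterally enforces $$P^*\left(\hat{\bm\sigma}^{(-1)},\dots,\hat{\bm\sigma}^{(-n)}\right)=0.$$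
   Context: Game: the set of players is $\mathcal N=\{1,\dots,N\}$; player $a$ has the finite action set $A_a=\{1,\dots,M_a\}$; $\mathcal A=\prod_{a=1}^N A_a$ is the set of action profiles $\bm\sigma=(\sigma_1,\dots,\sigma_N)$. The game is repeated infinitely often; $\bm\sigma(t)$ is the action profile in round $t\ge 1$. A (behavior) strategy of player $a$ is a sequence $\{T_a^{(t)}\}_{t\ge1}$, where $T_a^{(t)}$ maps each history in $\mathcal A^{t-1}$ to a probability distribution on $A_a$. Given strategies of all players, the joint distribution of the first $t$ profiles is $$\mathbb P_t(\bm\sigma(t),\dots,\bm\sigma(1))=\prod_{t'=1}^t\prod_{b=1}^N T_b^{(t')}(\sigma_b(t')|\bm\sigma(t'-1),\dots,\bm\sigma(1)).$$ Memory-$n$ strategy: a strategy of player $a$ is a (time-independent) memory-$n$ strategy if there is a single conditional probability $T_a(\sigma_a|\bm\sigma^{(-1)},\dots,\bm\sigma^{(-n)})$ such that $T_a^{(t)}(\sigma_a(t)|\bm\sigma(t-1),\dots,\bm\sigma(1))=T_a(\sigma_a(t)|\bm\sigma(t-1),\dots,\bm\sigma(t-n))$ for all $t>n$, all $\sigma_a(t)$ and all histories. Its Press–Dyson tensor is $\hat T_a(\sigma_a|\bm\sigma^{(-1)},\dots,\bm\sigma^{(-n)})=T_a(\sigma_a|\bm\sigma^{(-1)},\dots,\bm\sigma^{(-n)})-\delta_{\sigma_a,\sigma_a^{(-1)}}$; for $n=1$ it is called the Press–Dyson vectors. Limit distribution: for $t\ge n$ let $P_t(\bm\sigma(t),\dots,\bm\sigma(t-n+1))$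 be the marginal of $\mathbb P_t$ on the last $n$ profiles, and $$P^*(\bm\sigma^{(-1)},\dots,\bm\sigma^{(-n)})=\lim_{T\to\infty}\frac1T\sum_{t=n}^{T+n-1}P_t(\bm\sigma^{(-1)},\dots,\bm\sigma^{(-n)}),$$ where $\bm\sigma^{(-1)}$ is the most recent profile. It is assumed throughout that $P^*$ exists. "Unilaterally enforces" a relation means that, when player $a$ uses the stated strategy, the relation holds whatever the strategies of all other players are (these are arbitrary behavior strategies). Here $\delta_{\sigma,\sigma'}$ is the Kronecker delta and $\delta_{\bm\sigma,\hat{\bm\sigma}}=\prod_{b=1}^N\delta_{\sigma_b,\hat\sigma_b}$. *)

theory Defs
  imports "HOL-Probability.Probability_Mass_Function"
begin

text \<open>
  Players are \<open>{1..N}\<close> and player \<open>b\<close> has the actions \<open>{1..M b}\<close>. Every sequence of action profiles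
  is a list with the most recent profile first: the history before round \<open>t\<close> is
  \<open>[\<sigma>(t-1), \<dots>, \<sigma>(1)]\<close>, and the tuple \<open>(\<sigma>\<^sup>(\<^sup>-\<^sup>1\<^sup>), \<dots>, \<sigma>\<^sup>(\<^sup>-\<^sup>n\<^sup>))\<close> is a list \<open>w\<close> of length \<open>n\<close>
  with \<open>\<sigma>\<^sup>(\<^sup>-\<^sup>m\<^sup>) = w ! (m - 1)\<close>.
\<close>

type_synonym profile = "nat \<Rightarrow> nat"

type_synonym conditional = "profile list \<Rightarrow> nat pmf"

type_synonym strategy = "nat \<Rightarrow> profile list \<Rightarrow> nat pmf"

definition profiles :: "nat \<Rightarrow> (nat \<Rightarrow> nat) \<Rightarrow> profile set" where
  "profiles N M = (\<Pi>\<^sub>E b\<in>{1..N}. {1..M b})"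

definition histories :: "nat \<Rightarrow> (nat \<Rightarrow> nat) \<Rightarrow> nat \<Rightarrow> profile list set" where
  "histories N M k = {h. length h = k \<and> set h \<subseteq> profiles N M}"

definition conditional_prob :: "nat \<Rightarrow> (nat \<Rightarrow> nat) \<Rightarrow> nat \<Rightarrow> nat \<Rightarrow> conditional \<Rightarrow> bool" where
  "conditional_prob N M a k K \<longleftrightarrow> (\<forall>h\<in>histories N M k. set_pmf (K h) \<subseteq> {1..M a})"

definition is_strategy :: "nat \<Rightarrow> (nat \<Rightarrow> nat) \<Rightarrow> nat \<Rightarrow> strategy \<Rightarrow> bool" where
  "is_strategy N M a S \<longleftrightarrow> (\<forall>t\<ge>1. conditional_prob N M a (t - 1) (S t))"

text \<open>
  \<open>S\<close> is a memory-\<open>n\<close> strategy of player \<open>a\<close> with conditional probability \<open>K\<close>. The behaviour of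
  \<open>S\<close> in the first \<open>n\<close> rounds is unconstrained.
\<close>

definition is_memory_strategy ::
    "nat \<Rightarrow> (nat \<Rightarrow> nat) \<Rightarrow> nat \<Rightarrow> nat \<Rightarrow> strategy \<Rightarrow> conditional \<Rightarrow> bool" where
  "is_memory_strategy N M a n S K \<longleftrightarrow>
     is_strategy N M a S \<and> conditional_prob N M a n K \<and>
     (\<forall>t>n. \<forall>h\<in>histories N M (t - 1). \<forall>s\<in>{1..M a}. pmf (S t h) s = pmf (K (take n h)) s)"

definition kdelta :: "nat \<Rightarrow> nat \<Rightarrow> real" where
  "kdelta s s' = (if s = s' then 1 else 0)"

definition profile_delta :: "nat \<Rightarrow> profile \<Rightarrow> profile \<Rightarrow> real" where
  "profile_delta N x y = (\<Prod>b = 1..N. kdelta (x b) (y b))"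

definition press_dyson :: "nat \<Rightarrow> conditional \<Rightarrow> nat \<Rightarrow> profile list \<Rightarrow> real" where
  "press_dyson a K s w = pmf (K w) s - kdelta s ((w ! 0) a)"

text \<open>
  For \<open>h = [\<sigma>(t), \<dots>, \<sigma>(1)]\<close> and \<open>1 \<le> r \<le> t\<close>, \<open>h ! (t - r)\<close> is \<open>\<sigma>(r)\<close> and
  \<open>drop (t - r + 1) h\<close> is \<open>[\<sigma>(r-1), \<dots>, \<sigma>(1)]\<close>.
\<close>

definition joint_prob :: "nat \<Rightarrow> (nat \<Rightarrow> strategy) \<Rightarrow> nat \<Rightarrow> profile list \<Rightarrow> real" where
  "joint_prob N T t h =
     (\<Prod>r = 1..t. \<Prod>b = 1..N. pmf (T b r (drop (t - r + 1) h)) ((h ! (t - r)) b))"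

definition marginal_prob ::
    "nat \<Rightarrow> (nat \<Rightarrow> nat) \<Rightarrow> (nat \<Rightarrow> strategy) \<Rightarrow> nat \<Rightarrow> nat \<Rightarrow> profile list \<Rightarrow> real" where
  "marginal_prob N M T n t w = (\<Sum>h\<in>{h \<in> histories N M t. take n h = w}. joint_prob N T t h)"

definition time_average ::
    "nat \<Rightarrow> (nat \<Rightarrow> nat) \<Rightarrow> (nat \<Rightarrow> strategy) \<Rightarrow> nat \<Rightarrow> profile list \<Rightarrow> nat \<Rightarrow> real" where
  "time_average N M T n w L = 1 / real L * (\<Sum>t = n..L + n - 1. marginal_prob N M T n t w)"

definition limit_exists :: "nat \<Rightarrow> (nat \<Rightarrow> nat) \<Rightarrow> (nat \<Rightarrow> strategy) \<Rightarrow> nat \<Rightarrow> bool" where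
  "limit_exists N M T n \<longleftrightarrow> (\<forall>w\<in>histories N M n. convergent (time_average N M T n w))"

definition limit_distribution ::
    "nat \<Rightarrow> (nat \<Rightarrow> nat) \<Rightarrow> (nat \<Rightarrow> strategy) \<Rightarrow> nat \<Rightarrow> profile list \<Rightarrow> real" where
  "limit_distribution N M T n w = lim (time_average N M T n w)"

definition unilaterally_enforces ::
    "nat \<Rightarrow> (nat \<Rightarrow> nat) \<Rightarrow> nat \<Rightarrow> strategy \<Rightarrow> ((nat \<Rightarrow> strategy) \<Rightarrow> bool) \<Rightarrow> bool" where
  "unilaterally_enforces N M a S R \<longleftrightarrow>
     (\<forall>T. (\<forall>b\<in>{1..N}. is_strategy N M b (T b)) \<and> T a = S \<longrightarrow> R T)"

end

theory Submission
  imports Defs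
begin

text \<open>
  Fix an action \<open>s\<close> at which the Press--Dyson vector after \<open>\<sigma>hat ! 0\<close> has a nonzero entry \<open>d\<close>, and
  let \<open>q t\<close> be the probability that player \<open>a\<close> plays \<open>s\<close> in round \<open>t\<close>. The Press--Dyson tensor
  measures how the probability of \<open>s\<close> in the next round deviates from the repetition of the current
  action. Averaged over the histories of length \<open>t \<ge> n\<close>, it is therefore the increment
  \<open>q (t + 1) - q t\<close>, whatever the opponents do, because player \<open>a\<close>'s next action depends on them only
  through the history (\<open>action_prob_Suc\<close>). The tensor in question is \<open>d\<close> at the window \<open>\<sigma>hat\<close> and
  vanishes at every other window, so the increment equals \<open>d\<close> times the probability of seeing
  \<open>\<sigma>hat\<close> in the last \<open>n\<close> rounds (\<open>action_prob_increment\<close>).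

  The increments telescope and \<open>q\<close> takes values in \<open>[0, 1]\<close>. Hence \<open>d\<close> times the sum of the
  probabilities of \<open>\<sigma>hat\<close> over any number of rounds is at most 1 in absolute value, and dividing by
  the number of rounds sends the time average to 0.
\<close>

lemma finite_profiles: "finite (profiles N M)"
  unfolding profiles_def by (intro finite_PiE) auto

lemma finite_histories: "finite (histories N M k)"
proof -
  have "histories N M k = {h. set h \<subseteq> profiles N M \<and> length h = k}"
    unfolding histories_def by auto
  then show ?thesis
    using finite_lists_length_eq[OF finite_profiles] by simp
qed

lemma histories_0: "histories N M 0 = {[]}"
  unfolding histories_def by auto

lemma sum_histories_Suc:
  "(\<Sum>h\<in>histories N M (Suc k). f h) =
     (\<Sum>h\<in>histories N M k. \<Sum>x\<in>profiles N M. f (x # h))"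
proof -
  have img: "histories N M (Suc k) = (\<lambda>(h, x). x # h) ` (histories N M k \<times> profiles N M)"
  proof (intro equalityI subsetI)
    fix h assume "h \<in> histories N M (Suc k)"
    then obtain x h' where "h = x # h'" "x \<in> profiles N M" "h' \<in> histories N M k"
      unfolding histories_def by (cases h) auto
    then show "h \<in> (\<lambda>(h, x). x # h) ` (histories N M k \<times> profiles N M)"
      by force
  qed (auto simp: histories_def)
  have inj: "inj_on (\<lambda>(h, x). x # h) (histories N M k \<times> profiles N M)"
    by (auto simp: inj_on_def)
  show ?thesis
    unfolding img
    by (subst sum.reindex[OF inj]) (simp add: sum.cartesian_product case_prod_beta)
qed

lemma joint_prob_Cons:
  "joint_prob N T (Suc t) (x # h) =
     joint_prob N T t h * (\<Prod>b = 1..N. pmf (T b (Suc t) h) (x b))"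
proof -
  have "(\<Prod>r = 1..t. \<Prod>b = 1..N.
           pmf (T b r (drop (Suc t - r + 1) (x # h))) (((x # h) ! (Suc t - r)) b)) =
        joint_prob N T t h"
    unfolding joint_prob_def by (intro prod.cong refl) (auto simp: Suc_diff_le)
  then show ?thesis
    unfolding joint_prob_def[of N T "Suc t"] by (simp add: prod.nat_ivl_Suc')
qed

lemma joint_prob_nonneg: "0 \<le> joint_prob N T t h"
  unfolding joint_prob_def by (intro prod_nonneg ballI) simp

text \<open>
  Within a round the players randomize independently given the history, so an expectation that
  involves only player \<open>a\<close>'s action can be computed from player \<open>a\<close>'s own distribution.
\<close>

lemma sum_profiles_own_action:
  fixes p :: "nat \<Rightarrow> nat pmf" and g :: "nat \<Rightarrow> real"
  assumes "a \<in> {1..N}" and supp: "\<And>b. b \<in> {1..N} \<Longrightarrow> set_pmf (p b) \<subseteq> {1..M b}"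
  shows "(\<Sum>x\<in>profiles N M. (\<Prod>b = 1..N. pmf (p b) (x b)) * g (x a)) =
         (\<Sum>y = 1..M a. pmf (p a) y * g y)"
proof -
  define f where "f b y = pmf (p b) y * (if b = a then g y else 1)" for b y
  have "(\<Sum>x\<in>profiles N M. (\<Prod>b = 1..N. pmf (p b) (x b)) * g (x a)) =
        (\<Sum>x\<in>profiles N M. \<Prod>b = 1..N. f b (x b))"
    using assms(1) by (intro sum.cong refl) (simp add: f_def prod.distrib)
  also have "\<dots> = (\<Prod>b = 1..N. \<Sum>y = 1..M b. f b y)"
    unfolding profiles_def by (subst prod_sum_PiE) auto
  also have "\<dots> = (\<Prod>b = 1..N. if b = a then \<Sum>y = 1..M a. pmf (p a) y * g y else 1)"
    using supp by (intro prod.cong refl) (auto simp: f_def intro!: sum_pmf_eq_1)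
  also have "\<dots> = (\<Sum>y = 1..M a. pmf (p a) y * g y)"
    using assms(1) by simp
  finally show ?thesis .
qed

lemma strategy_support:
  assumes "is_strategy N M b S" "h \<in> histories N M t"
  shows "set_pmf (S (Suc t) h) \<subseteq> {1..M b}"
proof -
  have "conditional_prob N M b t (S (Suc t))"
    using assms(1)[unfolded is_strategy_def, rule_format, of "Suc t"] by simp
  then show ?thesis
    using assms(2) unfolding conditional_prob_def by blast
qed

text \<open>
  This is the probability that player \<open>a\<close> plays \<open>s\<close> in round \<open>t \<ge> 1\<close>. At \<open>t = 0\<close> there is no last
  action and the value has no meaning.
\<close>

definition action_prob ::
    "nat \<Rightarrow> (nat \<Rightarrow> nat) \<Rightarrow> (nat \<Rightarrow> strategy) \<Rightarrow> nat \<Rightarrow> nat \<Rightarrow> nat \<Rightarrow> real" where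
  "action_prob N M T a t s =
     (\<Sum>h\<in>histories N M t. joint_prob N T t h * kdelta s ((h ! 0) a))"

lemma sum_joint_prob_eq_1:
  assumes "a \<in> {1..N}" and strat: "\<And>b. b \<in> {1..N} \<Longrightarrow> is_strategy N M b (T b)"
  shows "(\<Sum>h\<in>histories N M t. joint_prob N T t h) = 1"
proof (induction t)
  case 0
  show ?case by (simp add: histories_0 joint_prob_def)
next
  case (Suc t)
  have "(\<Sum>x\<in>profiles N M. joint_prob N T (Suc t) (x # h)) = joint_prob N T t h"
    if h: "h \<in> histories N M t" for h
  proof -
    have supp: "set_pmf (T b (Suc t) h) \<subseteq> {1..M b}" if "b \<in> {1..N}" for b
      using strategy_support[OF strat[OF that] h] .
    have "(\<Sum>x\<in>profiles N M. \<Prod>b = 1..N. pmf (T b (Suc t) h) (x b)) =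
          (\<Sum>y = 1..M a. pmf (T a (Suc t) h) y)"
      using sum_profiles_own_action[OF assms(1), of "\<lambda>b. T b (Suc t) h" M "\<lambda>_. 1"] supp
      by simp
    also have "\<dots> = 1"
      using supp[OF assms(1)] by (intro sum_pmf_eq_1) auto
    finally show ?thesis
      by (simp add: joint_prob_Cons flip: sum_distrib_left)
  qed
  then show ?case
    using Suc.IH by (simp add: sum_histories_Suc)
qed

lemma action_prob_bounds:
  assumes "a \<in> {1..N}" and "\<And>b. b \<in> {1..N} \<Longrightarrow> is_strategy N M b (T b)"
  shows "0 \<le> action_prob N M T a t s" and "action_prob N M T a t s \<le> 1"
proof -
  show "0 \<le> action_prob N M T a t s"
    unfolding action_prob_def
    by (intro sum_nonneg mult_nonneg_nonneg joint_prob_nonneg) (simp add: kdelta_def)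
  have "action_prob N M T a t s \<le> (\<Sum>h\<in>histories N M t. joint_prob N T t h)"
    unfolding action_prob_def
    by (intro sum_mono) (simp add: kdelta_def joint_prob_nonneg)
  then show "action_prob N M T a t s \<le> 1"
    using sum_joint_prob_eq_1[OF assms] by simp
qed

lemma action_prob_Suc:
  assumes "a \<in> {1..N}" and strat: "\<And>b. b \<in> {1..N} \<Longrightarrow> is_strategy N M b (T b)"
    and "s \<in> {1..M a}"
  shows "action_prob N M T a (Suc t) s =
         (\<Sum>h\<in>histories N M t. joint_prob N T t h * pmf (T a (Suc t) h) s)"
proof -
  have "(\<Sum>x\<in>profiles N M. joint_prob N T (Suc t) (x # h) * kdelta s (x a)) =
        joint_prob N T t h * pmf (T a (Suc t) h) s" if h: "h \<in> histories N M t" for h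
  proof -
    have "(\<Sum>x\<in>profiles N M. (\<Prod>b = 1..N. pmf (T b (Suc t) h) (x b)) * kdelta s (x a)) =
          (\<Sum>y = 1..M a. pmf (T a (Suc t) h) y * kdelta s y)"
      using strategy_support[OF strat h] by (intro sum_profiles_own_action assms(1)) blast
    also have "\<dots> = (\<Sum>y = 1..M a. if s = y then pmf (T a (Suc t) h) y else 0)"
      by (intro sum.cong refl) (simp add: kdelta_def)
    also have "\<dots> = pmf (T a (Suc t) h) s"
      using assms(3) by simp
    finally show ?thesis
      by (simp add: joint_prob_Cons mult.assoc flip: sum_distrib_left)
  qed
  then show ?thesis
    unfolding action_prob_def by (simp add: sum_histories_Suc)
qed

lemma profile_delta_eq:
  assumes "x \<in> profiles N M" "y \<in> profiles N M"
  shows "profile_delta N x y = (if x = y then 1 else 0)"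
proof (cases "x = y")
  case True
  then show ?thesis by (simp add: profile_delta_def kdelta_def)
next
  case False
  \<comment> \<open>Both profiles are undefined outside \<open>{1..N}\<close>, so they differ at a player.\<close>
  then obtain b where "b \<in> {1..N}" "x b \<noteq> y b"
    using assms PiE_ext[of x _ _ y] unfolding profiles_def by blast
  then have "profile_delta N x y = 0"
    unfolding profile_delta_def by (intro prod_zero bexI[of _ b]) (auto simp: kdelta_def)
  then show ?thesis using False by simp
qed

lemma prod_profile_delta_eq:
  assumes "w \<in> histories N M n" "v \<in> histories N M n"
  shows "(\<Prod>m = 1..n. profile_delta N (w ! (m - 1)) (v ! (m - 1))) = (if w = v then 1 else 0)"
proof -
  have len: "length w = n" "length v = n"
    and mem: "\<And>i. i < n \<Longrightarrow> w ! i \<in> profiles N M" "\<And>i. i < n \<Longrightarrow> v ! i \<in> profiles N M"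
    using assms unfolding histories_def by auto
  have eq: "profile_delta N (w ! (m - 1)) (v ! (m - 1)) =
      (if w ! (m - 1) = v ! (m - 1) then 1 else 0)" if "m \<in> {1..n}" for m
    using that by (intro profile_delta_eq[of _ N M] mem) auto
  show ?thesis
  proof (cases "w = v")
    case True
    then show ?thesis using eq by (auto intro!: prod.neutral)
  next
    case False
    then obtain i where "i < n" "w ! i \<noteq> v ! i"
      using len nth_equalityI[of w v] by auto
    then have "(\<Prod>m = 1..n. profile_delta N (w ! (m - 1)) (v ! (m - 1))) = 0"
      using eq[of "Suc i"] by (intro prod_zero bexI[of _ "Suc i"]) auto
    then show ?thesis using False by simp
  qed
qed

text \<open>
  After a window other than \<open>w\<close>, player \<open>a\<close> plays \<open>s\<close> with probability 1 if the last action was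
  \<open>s\<close> and with probability 0 otherwise. So only the histories that end in \<open>w\<close> can change the
  probability of \<open>s\<close> from one round to the next, and each of them adds \<open>d\<close> times its weight.
\<close>

lemma action_prob_increment:
  assumes "a \<in> {1..N}" and strat: "\<And>b. b \<in> {1..N} \<Longrightarrow> is_strategy N M b (T b)"
    and mem: "is_memory_strategy N M a n (T a) K"
    and s: "s \<in> {1..M a}" and "1 \<le> n" "n \<le> t"
    and tensor: "\<And>v. v \<in> histories N M n \<Longrightarrow>
      press_dyson a K s v = (if v = w then d else 0)"
  shows "action_prob N M T a (Suc t) s - action_prob N M T a t s = d * marginal_prob N M T n t w"
proof -
  have step: "pmf (T a (Suc t) h) s - kdelta s ((h ! 0) a) = (if take n h = w then d else 0)"
    if h: "h \<in> histories N M t" for h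
  proof -
    have th: "take n h \<in> histories N M n"
      using h \<open>n \<le> t\<close> unfolding histories_def by (auto dest: in_set_takeD)
    have "n < Suc t" "h \<in> histories N M (Suc t - 1)"
      using h \<open>n \<le> t\<close> by simp_all
    then have "pmf (T a (Suc t) h) s = pmf (K (take n h)) s"
      using mem[unfolded is_memory_strategy_def] s by presburger
    moreover have "take n h ! 0 = h ! 0"
      using \<open>1 \<le> n\<close> by simp
    ultimately show ?thesis
      using tensor[OF th] by (simp add: press_dyson_def)
  qed
  have "action_prob N M T a (Suc t) s - action_prob N M T a t s =
        (\<Sum>h\<in>histories N M t.
           joint_prob N T t h * (pmf (T a (Suc t) h) s - kdelta s ((h ! 0) a)))"
    using action_prob_Suc[of a N M T s t] assms(1) strat s
    by (simp add: action_prob_def[of N M T a t s] right_diff_distrib sum_subtractf)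
  also have "\<dots> = (\<Sum>h\<in>histories N M t. if take n h = w then d * joint_prob N T t h else 0)"
    using step by (intro sum.cong refl) auto
  also have "\<dots> = (\<Sum>h\<in>{h \<in> histories N M t. take n h = w}. d * joint_prob N T t h)"
    using finite_histories by (simp add: sum.inter_filter)
  also have "\<dots> = d * marginal_prob N M T n t w"
    by (simp add: marginal_prob_def sum_distrib_left)
  finally show ?thesis .
qed

text \<open>
  The partial sums telescope to a difference of two values of \<open>q\<close>, so they stay bounded by
  \<open>1 / \<bar>d\<bar>\<close> while the number of averaged rounds grows.
\<close>

lemma time_average_tendsto_0:
  fixes q :: "nat \<Rightarrow> real"
  assumes "d \<noteq> 0"
    and bounds: "\<And>t. 0 \<le> q t" "\<And>t. q t \<le> 1"
    and increment: "\<And>t. n \<le> t \<Longrightarrow> q (Suc t) - q t = d * marginal_prob N M T n t w"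
  shows "time_average N M T n w \<longlonglongrightarrow> 0"
proof -
  have bound: "norm (time_average N M T n w L) \<le> 1 / \<bar>d\<bar> * inverse (real L)" if "1 \<le> L" for L
  proof -
    have "d * (\<Sum>t = n..L + n - 1. marginal_prob N M T n t w) =
          (\<Sum>t = n..L + n - 1. q (Suc t) - q t)"
      using increment by (simp add: sum_distrib_left)
    also have "\<dots> = q (L + n) - q n"
      using that by (subst sum_Suc_diff) auto
    finally have "\<bar>d * (\<Sum>t = n..L + n - 1. marginal_prob N M T n t w)\<bar> \<le> 1"
      using bounds[of "L + n"] bounds[of n] by simp
    then have "\<bar>\<Sum>t = n..L + n - 1. marginal_prob N M T n t w\<bar> \<le> 1 / \<bar>d\<bar>"
      using \<open>d \<noteq> 0\<close> by (simp add: abs_mult field_simps)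
    then have "\<bar>\<Sum>t = n..L + n - 1. marginal_prob N M T n t w\<bar> / real L \<le> 1 / \<bar>d\<bar> / real L"
      by (rule divide_right_mono) simp
    then show ?thesis
      by (simp add: time_average_def abs_mult divide_inverse mult.commute)
  qed
  have "(\<lambda>L. 1 / \<bar>d\<bar> * inverse (real L)) \<longlonglongrightarrow> 0"
    by (rule tendsto_mult_right_zero) (rule lim_inverse_n)
  then show ?thesis
    by (rule Lim_null_comparison[rotated])
      (use bound in \<open>auto simp: eventually_sequentially intro!: exI[of _ 1]\<close>)
qed

theorem proposition4:
  fixes N a n :: nat
    and M :: "nat \<Rightarrow> nat"
    and \<sigma>hat :: "profile list"
    and S1 S :: strategy
    and K1 K :: conditional
  assumes "a \<in> {1..N}"
    and "n \<ge> 1"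
    and "\<sigma>hat \<in> histories N M n"
    and "is_memory_strategy N M a 1 S1 K1"
    and "\<exists>s\<in>{1..M a}. press_dyson a K1 s [\<sigma>hat ! 0] \<noteq> 0"
    and "is_memory_strategy N M a n S K"
    and "\<And>s w. s \<in> {1..M a} \<Longrightarrow> w \<in> histories N M n \<Longrightarrow>
           press_dyson a K s w =
             press_dyson a K1 s [w ! 0] *
             (\<Prod>m = 1..n. profile_delta N (w ! (m - 1)) (\<sigma>hat ! (m - 1)))"
  shows "unilaterally_enforces N M a S
           (\<lambda>T. limit_exists N M T n \<longrightarrow> limit_distribution N M T n \<sigma>hat = 0)"
  unfolding unilaterally_enforces_def
proof (intro allI impI, elim conjE)
  fix T :: "nat \<Rightarrow> strategy"
  assume strat: "\<forall>b\<in>{1..N}. is_strategy N M b (T b)" and "T a = S"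
  obtain s where s: "s \<in> {1..M a}" and d: "press_dyson a K1 s [\<sigma>hat ! 0] \<noteq> 0"
    using assms(5) by blast
  have tensor: "press_dyson a K s v =
      (if v = \<sigma>hat then press_dyson a K1 s [\<sigma>hat ! 0] else 0)" if "v \<in> histories N M n" for v
    using assms(7)[OF s that] prod_profile_delta_eq[OF that assms(3)] by simp
  have "time_average N M T n \<sigma>hat \<longlonglongrightarrow> 0"
  proof (rule time_average_tendsto_0[where q = "\<lambda>t. action_prob N M T a t s", OF d])
    show "action_prob N M T a (Suc t) s - action_prob N M T a t s =
        press_dyson a K1 s [\<sigma>hat ! 0] * marginal_prob N M T n t \<sigma>hat" if "n \<le> t" for t
    proof (rule action_prob_increment[where n = n and K = K, OF assms(1)])
      show "is_memory_strategy N M a n (T a) K"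
        using assms(6) \<open>T a = S\<close> by simp
    qed (use strat s assms(2) that tensor in auto)
  qed (use action_prob_bounds[OF assms(1)] strat in blast)+
  then show "limit_distribution N M T n \<sigma>hat = 0"
    unfolding limit_distribution_def by (rule limI)
qed

end
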